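(* Let a strict intensity profile with $n$ agents and $n$ items have an intensity-efficient allocation, and suppose that it can be partitioned into monotonic sets and an envy-free set (the latter possibly empty). Then every strictly monotonic set (cell) in this partition is homeo-monotonic.
   Context: Let $A$ be a set of $n$ items and $N=\{1,\dots,n\}$ a set of $n$ agents. The intensity relation of agent $l$ is a binary relation $\dot{\succsim}_l$ on $A\times A$ with symmetric part $\dot{\sim}_l$; its induced preference on $A$ is $a\succsim_l b \Leftrightarrow (a,b)\,\dot{\succsim}_l\,(b,a)$, with asymmetric part $\succ_l$. $\dot{\succsim}_l$ is representable by a preference intensity function if there is $s_l:A\times A\to\mathbb{R}$ such that for all $a,b,c,d,e\in A$: (i) $(a,b)\,\dot{\succsim}_l\,(c,d)\Leftrightarrow s_l(a,b)\ge s_l(c,d)$; (ii) $(a,b)\,\dot{\succsim}_l\,(b,a)\Leftrightarrow s_l(a,b)\ge s_l(e,e)\ge s_l(b,a)$; (iii) $\min\{s_l(a,b),s_l(b,c)\}\ge s_l(e,e)$ implies $s_l(a,c)\ge\max\{s_l(a,b),s_l(b,c)\}$, and a strict inequality in the hypothesis implies a strict inequality in the conclusion; (iv) (reversal) $s_l(a,b)\ge s_l(c,d)\Leftrightarrow s_l(d,c)\ge s_l(b,a)$. Strictness: $(a,b)\,\dot{\sim}_l\,(c,d)$ fails for all distinct pairs $(a,b)\neq(c,d)$ with $a\ne b$, $c\ne d$. A strict intensity profile is a tuple $(\dot{\succsim}_1,\dots,\dot{\succsim}_n)$ of representable relations satisfying Strictness; each induced preference is then a strict linear order. From now on $s_l$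 denotes the canonical representation of $\dot{\succsim}_l$, i.e. the one with range $\{-k,\dots,-1,0,1,\dots,k\}$, $k=\binom n2$; it satisfies $s_l(a,a)=0$, $s_l(a,b)=-s_l(b,a)$ and $s_l(a,b)>0\Leftrightarrow a\succ_l b$. An allocation is a bijection $x:N\to A$, $i\mapsto x_i$. It is Pareto-efficient if no allocation $y$ satisfies $y_i\succsim_i x_i$ for all $i$ and $y_i\succ_i x_i$ for some $i$. Allocation $x$ intensity-dominates allocation $y$ if for every pair of distinct agents $(i,j)$ such that $(x_i,x_j)=(y_j,y_i)=(a,b)$ it holds that $s_i(a,b)\ge s_j(a,b)$, with strict inequality for some such pair. An allocation is intensity-efficient if it is Pareto-efficient and not intensity-dominated by another Pareto-efficient allocation. For $N'\subseteq N$, $A'\subseteq A$, the pair $\{N',A'\}$ is: - envy-free if $|N'|=|A'|$, the agents in $N'$ have pairwise distinct most preferred items in $A$, and these items lie in $A'$; - top-preference-coincident if all agents in $N'$ have the same preference restricted to $A'$ and, whenever $A'\subsetneq A$, $a'\succ_i a$ for all $a'\in A'$, $a\in A\setminus A'$, $i\in N'$; - monotonic if it is top-preference-coincident, $|N'|=|A'|=:r$ and, writing the common preference as $c_1\succ c_2\succ\cdots\succ c_r$ on $A'=\{c_1,\dots,c_r\}$, there is an enumeration $\pi(1),\dots,\pi(r)$ of the agents in $N'$ such that $s_{\pi(p)}(c_1,c_2)>s_{\pi(p)}(c_2,c_3)>\cdots>s_{\pi(p)}(c_{r-1},c_r)>0$ for each $p\le r$, and $s_{\pi(p)}(c_q,c_{q+1})\ge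 s_{\pi(p+1)}(c_q,c_{q+1})$ for all $p,q\le r-1$; - strictly monotonic if it is monotonic with all these inequalities strict; - homeo-monotonic if it is monotonic (with enumeration $\pi$) and $s_{\pi(i)}(c_i,c_j)\ge s_{\pi(j)}(c_i,c_j)$ for all $i<j\le r$. A profile can be partitioned into monotonic sets and an envy-free set (possibly empty) if there are pairs $\{N^i,A^i\}$, $i\le m$, such that $(N^i)_{i\le m}$ partitions $N$, $(A^i)_{i\le m}$ partitions $A$, and each $\{N^i,A^i\}$ is monotonic or envy-free (with at most one cell being designated as the envy-free one). *)

theory Defs
  imports Complex_Main "HOL-Library.Disjoint_Sets"
begin

section \<open>Intensity relations\<close>

text \<open>
  An intensity relation on a set of items \<open>A\<close> is a relation on \<open>A \<times> A\<close>; the membership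
  \<open>((a, b), (c, d)) \<in> R\<close> reads: having \<open>a\<close> instead of \<open>b\<close> is at least as strong an
  improvement as having \<open>c\<close> instead of \<open>d\<close>.
\<close>

type_synonym 'a intensity_rel = "('a \<times> 'a) rel"

definition weak_pref :: "'a intensity_rel \<Rightarrow> 'a \<Rightarrow> 'a \<Rightarrow> bool" where
  "weak_pref R a b \<longleftrightarrow> ((a, b), (b, a)) \<in> R"

definition strict_pref :: "'a intensity_rel \<Rightarrow> 'a \<Rightarrow> 'a \<Rightarrow> bool" where
  "strict_pref R a b \<longleftrightarrow> weak_pref R a b \<and> \<not> weak_pref R b a"

text \<open>
  In the third condition, the strict version has both \<open>s a b\<close> and \<open>s b c\<close> strictly above
  \<open>s e e\<close> (with only one of them strict, the conclusion would already fail for \<open>b = c\<close>).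
\<close>

definition represents :: "'a set \<Rightarrow> 'a intensity_rel \<Rightarrow> ('a \<Rightarrow> 'a \<Rightarrow> real) \<Rightarrow> bool" where
  "represents A R s \<longleftrightarrow>
     (\<forall>a\<in>A. \<forall>b\<in>A. \<forall>c\<in>A. \<forall>d\<in>A. ((a, b), (c, d)) \<in> R \<longleftrightarrow> s a b \<ge> s c d) \<and>
     (\<forall>a\<in>A. \<forall>b\<in>A. \<forall>e\<in>A. ((a, b), (b, a)) \<in> R \<longleftrightarrow> s a b \<ge> s e e \<and> s e e \<ge> s b a) \<and>
     (\<forall>a\<in>A. \<forall>b\<in>A. \<forall>c\<in>A. \<forall>e\<in>A.
        (min (s a b) (s b c) \<ge> s e e \<longrightarrow> s a c \<ge> max (s a b) (s b c)) \<and>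
        (min (s a b) (s b c) > s e e \<longrightarrow> s a c > max (s a b) (s b c))) \<and>
     (\<forall>a\<in>A. \<forall>b\<in>A. \<forall>c\<in>A. \<forall>d\<in>A. s a b \<ge> s c d \<longleftrightarrow> s d c \<ge> s b a)"

definition representable :: "'a set \<Rightarrow> 'a intensity_rel \<Rightarrow> bool" where
  "representable A R \<longleftrightarrow> (\<exists>s. represents A R s)"

definition strictness :: "'a set \<Rightarrow> 'a intensity_rel \<Rightarrow> bool" where
  "strictness A R \<longleftrightarrow>
     (\<forall>a\<in>A. \<forall>b\<in>A. \<forall>c\<in>A. \<forall>d\<in>A. a \<noteq> b \<and> c \<noteq> d \<and> (a, b) \<noteq> (c, d) \<longrightarrow>
        \<not> (((a, b), (c, d)) \<in> R \<and> ((c, d), (a, b)) \<in> R))"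

definition strict_intensity_profile ::
    "'a set \<Rightarrow> 'i set \<Rightarrow> ('i \<Rightarrow> 'a intensity_rel) \<Rightarrow> bool" where
  "strict_intensity_profile A N R \<longleftrightarrow>
     (\<forall>l\<in>N. R l \<subseteq> (A \<times> A) \<times> (A \<times> A) \<and> representable A (R l) \<and> strictness A (R l))"

definition canonical_representation ::
    "'a set \<Rightarrow> 'a intensity_rel \<Rightarrow> ('a \<Rightarrow> 'a \<Rightarrow> real) \<Rightarrow> bool" where
  "canonical_representation A R s \<longleftrightarrow>
     represents A R s \<and>
     (\<lambda>(a, b). s a b) ` (A \<times> A) =
       real_of_int ` {- int (card A choose 2) .. int (card A choose 2)}"

lemma canonical_representation_exists:
  assumes fin: "finite A" and ne: "A \<noteq> {}"
    and rep: "representable A R" and str: "strictness A R"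
  shows "\<exists>s. canonical_representation A R s"
proof -
  obtain f where f: "represents A R f"
    using rep by (auto simp: representable_def)
  define F where "F = (\<lambda>(a, b). f a b)"
  define V where "V = F ` (A \<times> A)"
  define rk where "rk v = card {w \<in> V. w < v}" for v
  define k where "k = card A choose 2"
  have finV: "finite V" using fin by (simp add: V_def)
  have V_in: "f a b \<in> V" if "a \<in> A" "b \<in> A" for a b
    using that by (force simp: V_def F_def)
  have rk_less: "rk v < rk w" if "v \<in> V" "v < w" for v w
    unfolding rk_def by (rule psubset_card_mono) (use finV that in auto)
  have rk_iff: "rk v < rk w \<longleftrightarrow> v < w" if "v \<in> V" "w \<in> V" for v w
    using rk_less that by (metis less_asym less_irrefl linorder_neqE_linordered_idom)
  have rk_le: "rk v \<le> rk w \<longleftrightarrow> v \<le> w" if "v \<in> V" "w \<in> V" for v w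
    using rk_iff[OF that(2,1)] by (meson not_le)
  obtain e0 where e0: "e0 \<in> A" using ne by auto
  have diag: "f e e = f e0 e0" if "e \<in> A" for e
  proof -
    have "((e, e), (e, e)) \<in> R" using f that by (simp add: represents_def)
    then show ?thesis using f that e0 unfolding represents_def by (meson antisym)
  qed
  have R_iff: "((a, b), (c, d)) \<in> R \<longleftrightarrow> f a b \<ge> f c d"
    if "a \<in> A" "b \<in> A" "c \<in> A" "d \<in> A" for a b c d
    using f that by (simp add: represents_def)
  have rev: "f a b \<ge> f c d \<longleftrightarrow> f d c \<ge> f b a"
    if "a \<in> A" "b \<in> A" "c \<in> A" "d \<in> A" for a b c d
    using f that unfolding represents_def by blast
  have distinct_vals: "f a b \<noteq> f c d"
    if "a \<in> A" "b \<in> A" "c \<in> A" "d \<in> A" "a \<noteq> b" "c \<noteq> d" "(a, b) \<noteq> (c, d)" for a b c d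
  proof
    assume "f a b = f c d"
    then have "((a, b), (c, d)) \<in> R" "((c, d), (a, b)) \<in> R" using R_iff that by simp_all
    then show False using str that unfolding strictness_def by blast
  qed
  have nondiag: "f a b \<noteq> f e0 e0" if "a \<in> A" "b \<in> A" "a \<noteq> b" for a b
  proof
    assume eq: "f a b = f e0 e0"
    have "f e0 e0 \<ge> f b a" using rev[of a b e0 e0] that e0 eq by simp
    moreover have "f b a \<ge> f e0 e0" using rev[of e0 e0 a b] that e0 eq by simp
    ultimately have "f a b = f b a" using eq by simp
    then show False using distinct_vals[of a b b a] that by auto
  qed
  let ?D = "A \<times> A - Id_on A"
  have AA: "A \<times> A = Id_on A \<union> ?D" by auto
  have Id_eq: "Id_on A = (\<lambda>a. (a, a)) ` A" by auto
  have "F ` Id_on A = (\<lambda>a. f a a) ` A"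
    unfolding Id_eq image_image by (simp add: F_def)
  also have "\<dots> = (\<lambda>a. f e0 e0) ` A"
    by (rule image_cong[OF refl diag])
  also have "\<dots> = {f e0 e0}" using ne by auto
  finally have "F ` (Id_on A \<union> ?D) = insert (f e0 e0) (F ` ?D)"
    by (simp only: image_Un) simp
  then have V_eq: "V = insert (f e0 e0) (F ` ?D)"
    unfolding V_def AA[symmetric] .
  have inj: "inj_on F ?D"
  proof (rule inj_onI)
    fix p q assume "p \<in> ?D" "q \<in> ?D" "F p = F q"
    then show "p = q"
      using distinct_vals[of "fst p" "snd p" "fst q" "snd q"]
      by (cases p; cases q) (auto simp: F_def)
  qed
  have notin: "f e0 e0 \<notin> F ` ?D"
  proof
    assume "f e0 e0 \<in> F ` ?D"
    then obtain a b where "(a, b) \<in> ?D" "f e0 e0 = f a b" by (auto simp: F_def)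
    then show False using nondiag[of a b] by auto
  qed
  have cardId: "card (Id_on A) = card A"
    unfolding Id_eq by (simp add: card_image inj_on_def)
  have "card ?D = card A * card A - card A"
  proof -
    have "finite (Id_on A)" unfolding Id_eq using fin by simp
    moreover have "Id_on A \<subseteq> A \<times> A" by auto
    ultimately show ?thesis
      by (simp add: card_Diff_subset cardId card_cartesian_product)
  qed
  also have "\<dots> = 2 * k"
    unfolding k_def choose_two by (simp add: right_diff_distrib')
  finally have cardD: "card ?D = 2 * k" .
  have cardV: "card V = Suc (2 * k)"
    unfolding V_eq using fin notin by (simp add: card_image[OF inj] cardD)
  have rk_lt: "rk v < Suc (2 * k)" if "v \<in> V" for v
    unfolding rk_def cardV[symmetric] by (rule psubset_card_mono) (use finV that in auto)
  have rk_inj: "inj_on rk V"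
    by (rule inj_onI) (metis rk_less nat_neq_iff linorder_neqE_linordered_idom)
  have rk_img: "rk ` V = {..2 * k}"
    by (rule card_subset_eq) (use rk_lt cardV in \<open>auto simp: card_image[OF rk_inj] less_Suc_eq_le\<close>)
  define g where "g a b = real (rk (f a b)) - real k" for a b
  have g_le: "g a b \<le> g c d \<longleftrightarrow> f a b \<le> f c d"
    if "a \<in> A" "b \<in> A" "c \<in> A" "d \<in> A" for a b c d
    using that by (simp add: g_def rk_le V_in)
  have g_less: "g a b < g c d \<longleftrightarrow> f a b < f c d"
    if "a \<in> A" "b \<in> A" "c \<in> A" "d \<in> A" for a b c d
    using that by (simp add: g_def rk_iff V_in)
  have "represents A R g = represents A R f"
    unfolding represents_def by (simp add: g_le g_less)
  then have "represents A R g" using f by simp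
  moreover have "(\<lambda>(a, b). g a b) ` (A \<times> A) = real_of_int ` {- int k .. int k}"
  proof -
    have "(\<lambda>(a, b). g a b) ` (A \<times> A) = (\<lambda>m. real m - real k) ` rk ` V"
      by (simp add: V_def F_def image_image g_def case_prod_unfold)
    also have "\<dots> = (\<lambda>m. real_of_int (int m - int k)) ` {..2 * k}"
      by (simp add: rk_img)
    also have "\<dots> = real_of_int ` (\<lambda>m. int m - int k) ` {..2 * k}"
      by (simp add: image_image)
    also have "(\<lambda>m. int m - int k) ` {..2 * k} = {- int k .. int k}"
    proof (intro equalityI subsetI)
      fix z assume "z \<in> {- int k .. int k}"
      then show "z \<in> (\<lambda>m. int m - int k) ` {..2 * k}"
        by (intro image_eqI[of _ _ "nat (z + int k)"]) auto
    qed auto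
    finally show ?thesis .
  qed
  ultimately show ?thesis
    unfolding canonical_representation_def k_def by blast
qed

section \<open>Allocations\<close>

definition allocation :: "'a set \<Rightarrow> 'i set \<Rightarrow> ('i \<Rightarrow> 'a) \<Rightarrow> bool" where
  "allocation A N x \<longleftrightarrow> bij_betw x N A"

definition pareto_efficient ::
    "'a set \<Rightarrow> 'i set \<Rightarrow> ('i \<Rightarrow> 'a intensity_rel) \<Rightarrow> ('i \<Rightarrow> 'a) \<Rightarrow> bool" where
  "pareto_efficient A N R x \<longleftrightarrow>
     allocation A N x \<and>
     \<not> (\<exists>y. allocation A N y \<and>
           (\<forall>i\<in>N. weak_pref (R i) (y i) (x i)) \<and> (\<exists>i\<in>N. strict_pref (R i) (y i) (x i)))"

definition intensity_dominates ::
    "'i set \<Rightarrow> ('i \<Rightarrow> 'a \<Rightarrow> 'a \<Rightarrow> real) \<Rightarrow> ('i \<Rightarrow> 'a) \<Rightarrow> ('i \<Rightarrow> 'a) \<Rightarrow> bool" where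
  "intensity_dominates N s x y \<longleftrightarrow>
     (\<forall>i\<in>N. \<forall>j\<in>N. i \<noteq> j \<and> x i = y j \<and> x j = y i \<longrightarrow>
        s i (x i) (x j) \<ge> s j (x i) (x j)) \<and>
     (\<exists>i\<in>N. \<exists>j\<in>N. i \<noteq> j \<and> x i = y j \<and> x j = y i \<and>
        s i (x i) (x j) > s j (x i) (x j))"

text \<open>
  An allocation never intensity-dominates itself, since it assigns different items to
  different agents; so the dominating allocation below is automatically another one.
\<close>

definition intensity_efficient ::
    "'a set \<Rightarrow> 'i set \<Rightarrow> ('i \<Rightarrow> 'a intensity_rel) \<Rightarrow> ('i \<Rightarrow> 'a \<Rightarrow> 'a \<Rightarrow> real) \<Rightarrow> ('i \<Rightarrow> 'a) \<Rightarrow> bool"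
  where
  "intensity_efficient A N R s x \<longleftrightarrow>
     pareto_efficient A N R x \<and>
     \<not> (\<exists>y. pareto_efficient A N R y \<and> intensity_dominates N s y x)"

section \<open>Envy-free and monotonic sets\<close>

definition most_preferred :: "'a set \<Rightarrow> 'a intensity_rel \<Rightarrow> 'a \<Rightarrow> bool" where
  "most_preferred A R a \<longleftrightarrow> a \<in> A \<and> (\<forall>b\<in>A. b \<noteq> a \<longrightarrow> strict_pref R a b)"

definition envy_free ::
    "'a set \<Rightarrow> ('i \<Rightarrow> 'a intensity_rel) \<Rightarrow> 'i set \<Rightarrow> 'a set \<Rightarrow> bool" where
  "envy_free A R N' A' \<longleftrightarrow>
     card N' = card A' \<and>
     (\<exists>t. (\<forall>i\<in>N'. most_preferred A (R i) (t i)) \<and> inj_on t N' \<and> t ` N' \<subseteq> A')"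

definition top_preference_coincident ::
    "'a set \<Rightarrow> ('i \<Rightarrow> 'a intensity_rel) \<Rightarrow> 'i set \<Rightarrow> 'a set \<Rightarrow> bool" where
  "top_preference_coincident A R N' A' \<longleftrightarrow>
     (\<forall>i\<in>N'. \<forall>j\<in>N'. \<forall>a\<in>A'. \<forall>b\<in>A'. weak_pref (R i) a b \<longleftrightarrow> weak_pref (R j) a b) \<and>
     (\<forall>i\<in>N'. \<forall>a'\<in>A'. \<forall>a\<in>A - A'. strict_pref (R i) a' a)"

text \<open>
  \<open>ranks\<close>: the sequence \<open>c 1, ..., c r\<close>, where \<open>r = card A'\<close>, lists \<open>A'\<close> from best to worst
  for every agent in \<open>N'\<close>.
\<close>

definition ranks ::
    "('i \<Rightarrow> 'a intensity_rel) \<Rightarrow> 'i set \<Rightarrow> 'a set \<Rightarrow> (nat \<Rightarrow> 'a) \<Rightarrow> bool" where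
  "ranks R N' A' c \<longleftrightarrow>
     bij_betw c {1..card A'} A' \<and>
     (\<forall>i\<in>N'. \<forall>p\<in>{1..card A'}. \<forall>q\<in>{1..card A'}. p < q \<longrightarrow> strict_pref (R i) (c p) (c q))"

definition decreasing_intensities :: "('a \<Rightarrow> 'a \<Rightarrow> real) \<Rightarrow> nat \<Rightarrow> (nat \<Rightarrow> 'a) \<Rightarrow> bool" where
  "decreasing_intensities s r c \<longleftrightarrow>
     (\<forall>q. 1 \<le> q \<and> q + 2 \<le> r \<longrightarrow> s (c q) (c (q + 1)) > s (c (q + 1)) (c (q + 2))) \<and>
     (2 \<le> r \<longrightarrow> s (c (r - 1)) (c r) > 0)"

definition monotonic_enum ::
    "'a set \<Rightarrow> ('i \<Rightarrow> 'a intensity_rel) \<Rightarrow> ('i \<Rightarrow> 'a \<Rightarrow> 'a \<Rightarrow> real) \<Rightarrow>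
     'i set \<Rightarrow> 'a set \<Rightarrow> (nat \<Rightarrow> 'a) \<Rightarrow> (nat \<Rightarrow> 'i) \<Rightarrow> bool" where
  "monotonic_enum A R s N' A' c \<pi> \<longleftrightarrow>
     top_preference_coincident A R N' A' \<and> card N' = card A' \<and>
     ranks R N' A' c \<and> bij_betw \<pi> {1..card A'} N' \<and>
     (\<forall>p\<in>{1..card A'}. decreasing_intensities (s (\<pi> p)) (card A') c) \<and>
     (\<forall>p\<in>{1..<card A'}. \<forall>q\<in>{1..<card A'}.
        s (\<pi> p) (c q) (c (q + 1)) \<ge> s (\<pi> (p + 1)) (c q) (c (q + 1)))"

definition monotonic ::
    "'a set \<Rightarrow> ('i \<Rightarrow> 'a intensity_rel) \<Rightarrow> ('i \<Rightarrow> 'a \<Rightarrow> 'a \<Rightarrow> real) \<Rightarrow> 'i set \<Rightarrow> 'a set \<Rightarrow> bool"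
  where
  "monotonic A R s N' A' \<longleftrightarrow> (\<exists>c \<pi>. monotonic_enum A R s N' A' c \<pi>)"

definition strictly_monotonic ::
    "'a set \<Rightarrow> ('i \<Rightarrow> 'a intensity_rel) \<Rightarrow> ('i \<Rightarrow> 'a \<Rightarrow> 'a \<Rightarrow> real) \<Rightarrow> 'i set \<Rightarrow> 'a set \<Rightarrow> bool"
  where
  "strictly_monotonic A R s N' A' \<longleftrightarrow>
     (\<exists>c \<pi>. monotonic_enum A R s N' A' c \<pi> \<and>
        (\<forall>p\<in>{1..<card A'}. \<forall>q\<in>{1..<card A'}.
           s (\<pi> p) (c q) (c (q + 1)) > s (\<pi> (p + 1)) (c q) (c (q + 1))))"

definition homeo_monotonic ::
    "'a set \<Rightarrow> ('i \<Rightarrow> 'a intensity_rel) \<Rightarrow> ('i \<Rightarrow> 'a \<Rightarrow> 'a \<Rightarrow> real) \<Rightarrow> 'i set \<Rightarrow> 'a set \<Rightarrow> bool"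
  where
  "homeo_monotonic A R s N' A' \<longleftrightarrow>
     (\<exists>c \<pi>. monotonic_enum A R s N' A' c \<pi> \<and>
        (\<forall>i\<in>{1..card A'}. \<forall>j\<in>{1..card A'}. i < j \<longrightarrow>
           s (\<pi> i) (c i) (c j) \<ge> s (\<pi> j) (c i) (c j)))"

text \<open>
  \<open>E\<close> holds the index of the cell designated as envy-free, if there is one. Cells are allowed
  to be empty (this is intended for the envy-free one, and harmless for the others).
\<close>

definition monotonic_envy_free_partition ::
    "'a set \<Rightarrow> 'i set \<Rightarrow> ('i \<Rightarrow> 'a intensity_rel) \<Rightarrow> ('i \<Rightarrow> 'a \<Rightarrow> 'a \<Rightarrow> real) \<Rightarrow>
     nat \<Rightarrow> (nat \<Rightarrow> 'i set) \<Rightarrow> (nat \<Rightarrow> 'a set) \<Rightarrow> bool" where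
  "monotonic_envy_free_partition A N R s m Ns As \<longleftrightarrow>
     disjoint_family_on Ns {1..m} \<and> (\<Union>i\<in>{1..m}. Ns i) = N \<and>
     disjoint_family_on As {1..m} \<and> (\<Union>i\<in>{1..m}. As i) = A \<and>
     (\<exists>E\<subseteq>{1..m}. card E \<le> 1 \<and>
        (\<forall>i\<in>E. envy_free A R (Ns i) (As i)) \<and>
        (\<forall>i\<in>{1..m} - E. monotonic A R s (Ns i) (As i)))"

end

theory Submission imports Defs "HOL-Combinatorics.Transposition" begin

text \<open>
  In a Pareto-efficient allocation every cell of the partition receives its own items, and the
  agents of the envy-free cell receive their favourite items; conversely every such allocation
  is Pareto-efficient, since all agents of a monotonic cell rank its items in the same way.
  Exchanging the items of two agents of a monotonic cell therefore preserves Pareto-efficiency,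
  so in an intensity-efficient allocation no such exchange is an intensity-improvement. In a
  strictly monotonic cell, applying this to the holders of \<open>c q\<close> and \<open>c (q + 1)\<close> forces
  agent \<open>\<pi> q\<close> to hold \<open>c q\<close> for every \<open>q\<close>; applying it to the holders \<open>\<pi> i\<close> and \<open>\<pi> j\<close> of
  \<open>c i\<close> and \<open>c j\<close> gives the inequalities of homeo-monotonicity.
\<close>

section \<open>Strictly increasing maps on finite chains\<close>

text \<open>If some point moves down, the least such point is sent to a smaller point that also
  moves down, a contradiction; dually for the greatest point that moves up.\<close>

lemma strict_mono_on_finite_self_map:
  fixes f :: "'b::linorder \<Rightarrow> 'b"
  assumes fin: "finite S" and self: "\<And>v. v \<in> S \<Longrightarrow> f v \<in> S" and mono: "strict_mono_on S f"
    and v: "v \<in> S"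
  shows "f v = v"
proof (rule ccontr)
  have less: "f u < f w" if "u \<in> S" "w \<in> S" "u < w" for u w
    using mono that by (simp add: strict_mono_onD)
  assume "f v \<noteq> v"
  then consider "f v < v" | "v < f v" by (meson neqE)
  then show False
  proof cases
    case 1
    define T where "T = {u \<in> S. f u < u}"
    have T: "finite T" "T \<noteq> {}" using fin v 1 by (auto simp: T_def)
    define u where "u = Min T"
    have "u \<in> T" using Min_in[OF T] by (simp add: u_def)
    then have "f u \<in> T" using less self by (auto simp: T_def)
    then have "u \<le> f u" using T by (simp add: u_def)
    with \<open>u \<in> T\<close> show False by (auto simp: T_def)
  next
    case 2
    define T where "T = {u \<in> S. u < f u}"
    have T: "finite T" "T \<noteq> {}" using fin v 2 by (auto simp: T_def)
    define u where "u = Max T"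
    have "u \<in> T" using Max_in[OF T] by (simp add: u_def)
    then have "f u \<in> T" using less self by (auto simp: T_def)
    then have "f u \<le> u" using T by (simp add: u_def)
    with \<open>u \<in> T\<close> show False by (auto simp: T_def)
  qed
qed

lemma strict_mono_on_atLeastAtMostI_Suc:
  fixes f :: "nat \<Rightarrow> 'b::order"
  assumes "\<And>p. a \<le> p \<Longrightarrow> p < b \<Longrightarrow> f p < f (Suc p)"
  shows "strict_mono_on {a..b} f"
proof (rule strict_mono_onI)
  fix p q assume "p \<in> {a..b}" "q \<in> {a..b}" "p < q"
  have "Suc p \<le> q" using \<open>p < q\<close> by simp
  then have "q \<le> b \<longrightarrow> f p < f q"
  proof (induction q rule: dec_induct)
    case base
    then show ?case using assms \<open>p \<in> {a..b}\<close> by simp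
  next
    case (step q)
    then have "q < b \<longrightarrow> f q < f (Suc q)" using assms \<open>p \<in> {a..b}\<close> by simp
    then show ?case using step.IH less_trans by fastforce
  qed
  then show "f p < f q" using \<open>q \<in> {a..b}\<close> by simp
qed

section \<open>Antisymmetry of canonical representations\<close>

text \<open>The range of \<open>s\<close> is finite and symmetric about 0. By reversal, sending the
  value of a pair to the negated value of the reversed pair is a strictly increasing self-map of
  that range, hence the identity.\<close>

lemma canonical_representation_antisym:
  assumes can: "canonical_representation A R s" and "a \<in> A" "b \<in> A"
  shows "s b a = - s a b"
proof -
  define V where "V = real_of_int ` {- int (card A choose 2) .. int (card A choose 2)}"
  have V: "V = (\<lambda>(a, b). s a b) ` (A \<times> A)"
    using can by (simp add: canonical_representation_def V_def)
  have neg: "- v \<in> V" if "v \<in> V" for v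
  proof -
    obtain z where "z \<in> {- int (card A choose 2) .. int (card A choose 2)}" "v = real_of_int z"
      using \<open>v \<in> V\<close> unfolding V_def by blast
    then show ?thesis unfolding V_def by (intro image_eqI[of _ _ "- z"]) auto
  qed
  have rev: "s a b \<ge> s c d \<longleftrightarrow> s d c \<ge> s b a"
    if "a \<in> A" "b \<in> A" "c \<in> A" "d \<in> A" for a b c d
    using can that unfolding canonical_representation_def represents_def by blast
  have "\<forall>v\<in>V. \<exists>p\<in>A \<times> A. v = s (fst p) (snd p)"
    unfolding V by force
  then obtain p where p: "\<And>v. v \<in> V \<Longrightarrow> p v \<in> A \<times> A"
      "\<And>v. v \<in> V \<Longrightarrow> s (fst (p v)) (snd (p v)) = v"
    by metis
  define g where "g v = - s (snd (p v)) (fst (p v))" for v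
  have mem: "fst (p v) \<in> A" "snd (p v) \<in> A" if "v \<in> V" for v
    using p(1)[OF that] by (auto simp: mem_Times_iff)
  have "g v = v" if "v \<in> V" for v
  proof (rule strict_mono_on_finite_self_map[of V g])
    show "finite V" by (simp add: V_def)
    show "g w \<in> V" if "w \<in> V" for w
      unfolding g_def by (rule neg) (use mem[OF that] V in auto)
    show "strict_mono_on V g"
    proof (rule strict_mono_onI)
      fix u w assume uw: "u \<in> V" "w \<in> V" "u < w"
      have "\<not> s (fst (p u)) (snd (p u)) \<ge> s (fst (p w)) (snd (p w))"
        using uw p(2) by simp
      then have "\<not> s (snd (p w)) (fst (p w)) \<ge> s (snd (p u)) (fst (p u))"
        using rev mem[OF uw(1)] mem[OF uw(2)] by blast
      then show "g u < g w" by (simp add: g_def)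
    qed
  qed fact
  moreover have ab: "s a b \<in> V" using assms(2,3) V by auto
  \<comment> \<open>The pair chosen for the value \<open>s a b\<close> need not be
    \<open>(a, b)\<close>, but by reversal two pairs of equal value have reversed pairs of equal
    value.\<close>
  moreover have "g (s a b) = - s b a"
  proof -
    have "s (fst (p (s a b))) (snd (p (s a b))) = s a b" using p(2) ab by blast
    then have "s (snd (p (s a b))) (fst (p (s a b))) = s b a"
      using rev[OF assms(2,3) mem[OF ab]] rev[OF mem[OF ab] assms(2,3)] by simp
    then show ?thesis by (simp add: g_def)
  qed
  ultimately show ?thesis by fastforce
qed

lemma canonical_representation_weak_pref_refl:
  assumes "canonical_representation A R s" "a \<in> A"
  shows "weak_pref R a a"
proof -
  have "((a, a), (a, a)) \<in> R \<longleftrightarrow> s a a \<ge> s a a"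
    using assms unfolding canonical_representation_def represents_def by blast
  then show ?thesis by (simp add: weak_pref_def)
qed

section \<open>Improvements and rigidity within a single cell\<close>

text \<open>Agents holding an item of \<open>B\<close> keep it. As \<open>x\<close> is injective,
  the other agents are as many as the items left in \<open>B\<close>, so a bijection serves
  them.\<close>

lemma ex_image_eq_extending_on_target:
  assumes fin: "finite N" "finite B" and inj: "inj_on x N" and card: "card N = card B"
  shows "\<exists>h. h ` N = B \<and> (\<forall>i\<in>N. x i \<in> B \<longrightarrow> h i = x i)"
proof -
  define M where "M = {i \<in> N. x i \<in> B}"
  have M: "M \<subseteq> N" "x ` M \<subseteq> B" by (auto simp: M_def)
  have "inj_on x M" using inj M(1) inj_on_subset by blast
  then have "card (x ` M) = card M" by (rule card_image)
  then have "card (N - M) = card (B - x ` M)"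
    using M fin card by (simp add: card_Diff_subset finite_subset[OF M(1)])
  then obtain g where g: "bij_betw g (N - M) (B - x ` M)"
    using finite_same_card_bij fin by blast
  define h where "h i = (if i \<in> M then x i else g i)" for i
  have "h ` N = x ` M \<union> g ` (N - M)" using M(1) by (auto simp: h_def)
  also have "\<dots> = B" using g M(2) by (auto simp: bij_betw_def)
  finally show ?thesis by (intro exI[of _ h]) (auto simp: h_def M_def)
qed

text \<open>Only agents holding an item outside \<open>A'\<close> change their item, and each of
  them gains from any item of \<open>A'\<close>.\<close>

lemma top_preference_coincident_improvement:
  assumes tpc: "top_preference_coincident A R N' A'" and card: "card N' = card A'"
    and fin: "finite N'" "finite A'" and x: "inj_on x N'" "x ` N' \<subseteq> A"
  shows "\<exists>h. h ` N' = A' \<and> (\<forall>i\<in>N'. h i = x i \<or> strict_pref (R i) (h i) (x i))"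
proof -
  obtain h where h: "h ` N' = A'" "\<forall>i\<in>N'. x i \<in> A' \<longrightarrow> h i = x i"
    using ex_image_eq_extending_on_target[OF fin x(1) card] by blast
  have "h i = x i \<or> strict_pref (R i) (h i) (x i)" if i: "i \<in> N'" for i
  proof (cases "x i \<in> A'")
    case False
    then have "x i \<in> A - A'" "h i \<in> A'" using i x(2) h(1) by auto
    then show ?thesis using tpc i unfolding top_preference_coincident_def by blast
  qed (use h(2) i in blast)
  with h(1) show ?thesis by blast
qed

text \<open>The improvement is the assignment of favourites, which exhausts \<open>A'\<close> by
  counting.\<close>

lemma envy_free_improvement:
  assumes ef: "envy_free A R N' A'" and fin: "finite A'" and x: "x ` N' \<subseteq> A"
  shows "\<exists>h. h ` N' = A' \<and> (\<forall>i\<in>N'. h i = x i \<or> strict_pref (R i) (h i) (x i)) \<and>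
             (\<forall>i\<in>N'. most_preferred A (R i) (h i))"
proof -
  obtain t where t: "\<forall>i\<in>N'. most_preferred A (R i) (t i)" "inj_on t N'" "t ` N' \<subseteq> A'"
    and card: "card N' = card A'"
    using ef by (auto simp: envy_free_def)
  have "t ` N' = A'" using t card fin by (simp add: card_image card_subset_eq)
  moreover have "\<forall>i\<in>N'. t i = x i \<or> strict_pref (R i) (t i) (x i)"
    using t(1) x unfolding most_preferred_def by (metis image_subset_iff)
  ultimately show ?thesis using t(1) by blast
qed

text \<open>A changed item would make \<open>y\<close> a Pareto improvement on \<open>x\<close>;
  \<open>refl\<close> supplies the weak preference of agents whose item is unchanged.\<close>

lemma pareto_efficient_no_improvement:
  assumes pe: "pareto_efficient A N R x" and y: "allocation A N y"
    and imp: "\<And>i. i \<in> N \<Longrightarrow> y i = x i \<or> strict_pref (R i) (y i) (x i)"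
    and refl: "\<And>i a. i \<in> N \<Longrightarrow> a \<in> A \<Longrightarrow> weak_pref (R i) a a" and i: "i \<in> N"
  shows "y i = x i"
proof (rule ccontr)
  assume "y i \<noteq> x i"
  then have "strict_pref (R i) (y i) (x i)" using imp[OF i] by simp
  moreover have x: "bij_betw x N A" using pe by (simp add: pareto_efficient_def allocation_def)
  have "weak_pref (R j) (y j) (x j)" if "j \<in> N" for j
    using imp[OF that] refl[OF that] bij_betw_apply[OF x that] by (auto simp: strict_pref_def)
  ultimately show False using pe y i unfolding pareto_efficient_def by blast
qed

lemma most_preferred_weak_pref_eq:
  assumes "most_preferred A R a" "b \<in> A" "weak_pref R b a"
  shows "b = a"
  using assms unfolding most_preferred_def strict_pref_def by blast

text \<open>Since \<open>z\<close> must also distribute exactly the items of \<open>A'\<close>, the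
  ranks received under \<open>z\<close> and under \<open>x\<close> have the same sum. No agent's
  rank gets worse, so no rank changes.\<close>

lemma ranks_weak_pref_eq:
  assumes tpc: "top_preference_coincident A R N' A'" and rk: "ranks R N' A' c"
    and fin: "finite N'" and x: "bij_betw x N' A'"
    and z: "inj_on z N'" "z ` N' \<subseteq> A"
    and weak: "\<And>i. i \<in> N' \<Longrightarrow> weak_pref (R i) (z i) (x i)" and i: "i \<in> N'"
  shows "z i = x i"
proof -
  have zA': "z j \<in> A'" if j: "j \<in> N'" for j
  proof (rule ccontr)
    assume "z j \<notin> A'"
    then have "z j \<in> A - A'" "x j \<in> A'" using z(2) j x by (auto simp: bij_betw_def)
    then have "strict_pref (R j) (x j) (z j)"
      using tpc j unfolding top_preference_coincident_def by blast
    then show False using weak[OF j] by (simp add: strict_pref_def)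
  qed
  have "z ` N' = A'"
  proof (rule card_subset_eq)
    show "finite A'" using bij_betw_finite[OF x] fin by simp
    show "card (z ` N') = card A'" using z(1) x by (simp add: card_image bij_betw_same_card)
  qed (use zA' in blast)
  with z(1) have z_bij: "bij_betw z N' A'" by (simp add: bij_betw_def)
  \<comment> \<open>The rank of an item in the common order, 1 being the best.\<close>
  define \<rho> where "\<rho> = the_inv_into {1..card A'} c"
  have c: "bij_betw c {1..card A'} A'" using rk by (simp add: ranks_def)
  have \<rho>: "\<rho> a \<in> {1..card A'}" "c (\<rho> a) = a" if "a \<in> A'" for a
    using bij_betw_apply[OF bij_betw_the_inv_into[OF c] that]
      f_the_inv_into_f_bij_betw[OF c] that unfolding \<rho>_def by blast+
  have le: "\<rho> (z j) \<le> \<rho> (x j)" if j: "j \<in> N'" for j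
  proof (rule ccontr)
    assume "\<not> \<rho> (z j) \<le> \<rho> (x j)"
    moreover have "x j \<in> A'" using x j by (auto simp: bij_betw_def)
    ultimately have "strict_pref (R j) (c (\<rho> (x j))) (c (\<rho> (z j)))"
      using rk j \<rho>(1)[OF zA'[OF j]] \<rho>(1)[of "x j"] unfolding ranks_def by simp
    then show False
      using weak[OF j] \<rho>(2)[OF zA'[OF j]] \<rho>(2)[OF \<open>x j \<in> A'\<close>] by (simp add: strict_pref_def)
  qed
  \<comment> \<open>Both sides are the sum of \<open>\<rho>\<close> over \<open>A'\<close>.\<close>
  have "(\<Sum>j\<in>N'. \<rho> (z j)) = (\<Sum>j\<in>N'. \<rho> (x j))"
    using sum.reindex_bij_betw[OF z_bij, of \<rho>] sum.reindex_bij_betw[OF x, of \<rho>] by simp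
  then have "\<rho> (z i) = \<rho> (x i)"
    using le fin i sum_strict_mono_ex1[of N' "\<lambda>j. \<rho> (z j)" "\<lambda>j. \<rho> (x j)"]
    by (metis le_neq_implies_less less_irrefl)
  moreover have "x i \<in> A'" using x i by (auto simp: bij_betw_def)
  ultimately show ?thesis using \<rho>(2) zA'[OF i] by metis
qed

section \<open>Strictly monotonic cells\<close>

text \<open>Let \<open>\<sigma> p\<close> be the position in \<open>\<pi>\<close> of the holder of
  \<open>c p\<close>. Stability between the holders of consecutive items makes
  \<open>\<sigma>\<close> strictly increasing, because intensities fall strictly along
  \<open>\<pi>\<close>; so \<open>\<sigma>\<close> is the identity.\<close>

lemma strictly_monotonic_assignment:
  fixes s :: "'i \<Rightarrow> 'a \<Rightarrow> 'a \<Rightarrow> real"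
  assumes x: "bij_betw x N' A'" and \<pi>: "bij_betw \<pi> {1..card A'} N'"
    and c: "bij_betw c {1..card A'} A'"
    and strict: "\<And>p q. p \<in> {1..<card A'} \<Longrightarrow> q \<in> {1..<card A'} \<Longrightarrow>
       s (\<pi> p) (c q) (c (q + 1)) > s (\<pi> (p + 1)) (c q) (c (q + 1))"
    and stable: "\<And>i j. i \<in> N' \<Longrightarrow> j \<in> N' \<Longrightarrow> i \<noteq> j \<Longrightarrow> s i (x i) (x j) \<ge> s j (x i) (x j)"
    and q: "q \<in> {1..card A'}"
  shows "x (\<pi> q) = c q"
proof -
  let ?I = "{1..card A'}"
  have "bij_betw (x \<circ> \<pi>) ?I A'" by (rule bij_betw_trans[OF \<pi> x])
  then have "\<forall>p\<in>?I. \<exists>k\<in>?I. x (\<pi> k) = c p"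
    using c unfolding bij_betw_def by (metis comp_apply image_iff)
  then obtain \<sigma> where \<sigma>: "\<And>p. p \<in> ?I \<Longrightarrow> \<sigma> p \<in> ?I" "\<And>p. p \<in> ?I \<Longrightarrow> x (\<pi> (\<sigma> p)) = c p"
    by metis
  have \<sigma>N: "\<pi> (\<sigma> p) \<in> N'" if "p \<in> ?I" for p
    using \<sigma>(1)[OF that] \<pi> by (auto simp: bij_betw_def)
  have "strict_mono_on ?I \<sigma>"
  proof (rule strict_mono_on_atLeastAtMostI_Suc)
    fix p assume p: "1 \<le> p" "p < card A'"
    then have pI: "p \<in> ?I" "Suc p \<in> ?I" by auto
    have "c p \<noteq> c (Suc p)" using c pI by (auto simp: bij_betw_def dest: inj_onD)
    then have ne: "\<sigma> p \<noteq> \<sigma> (Suc p)" and ne': "\<pi> (\<sigma> p) \<noteq> \<pi> (\<sigma> (Suc p))"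
      using \<sigma>(2)[OF pI(1)] \<sigma>(2)[OF pI(2)] by auto
    \<comment> \<open>The sign turns the decrease along \<open>\<pi>\<close> into an
      increase.\<close>
    have mono: "strict_mono_on ?I (\<lambda>k. - s (\<pi> k) (c p) (c (Suc p)))"
      by (rule strict_mono_on_atLeastAtMostI_Suc) (use strict[of _ p] p in auto)
    have "s (\<pi> (\<sigma> p)) (c p) (c (Suc p)) \<ge> s (\<pi> (\<sigma> (Suc p))) (c p) (c (Suc p))"
      using stable[OF \<sigma>N[OF pI(1)] \<sigma>N[OF pI(2)] ne'] \<sigma>(2) pI by simp
    then have "\<not> \<sigma> (Suc p) < \<sigma> p"
      using strict_mono_onD[OF mono \<sigma>(1)[OF pI(2)] \<sigma>(1)[OF pI(1)]] by auto
    with ne show "\<sigma> p < \<sigma> (Suc p)" by simp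
  qed
  then have "\<sigma> q = q"
    using strict_mono_on_finite_self_map[of ?I \<sigma>] \<sigma>(1) q by blast
  with \<sigma>(2)[OF q] show ?thesis by simp
qed

text \<open>Two agents with different favourites in \<open>A'\<close> would rank these two items in
  opposite ways. This settles the case of a strictly monotonic cell that is designated as
  envy-free.\<close>

lemma envy_free_top_preference_coincident_card_le_1:
  assumes ef: "envy_free A R N' A'" and tpc: "top_preference_coincident A R N' A'"
    and "A' \<subseteq> A"
  shows "card A' \<le> 1"
proof -
  obtain t where t: "\<forall>i\<in>N'. most_preferred A (R i) (t i)" "inj_on t N'" "t ` N' \<subseteq> A'"
    and card: "card N' = card A'"
    using ef by (auto simp: envy_free_def)
  have "i = j" if ij: "i \<in> N'" "j \<in> N'" for i j
  proof (rule inj_onD[OF t(2) _ ij], rule ccontr)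
    assume ne: "t i \<noteq> t j"
    have "t i \<in> A'" "t j \<in> A'" using t(3) ij by auto
    moreover have "strict_pref (R i) (t i) (t j)" "strict_pref (R j) (t j) (t i)"
      using t(1) ij ne \<open>A' \<subseteq> A\<close> calculation unfolding most_preferred_def by (metis subsetD)+
    ultimately show False
      using tpc ij unfolding top_preference_coincident_def strict_pref_def by blast
  qed
  \<comment> \<open>An infinite \<open>N'\<close> has cardinality 0 by convention.\<close>
  then have "card N' \<le> 1" by (cases "finite N'") (simp_all add: card_le_Suc0_iff_eq)
  with card show ?thesis by simp
qed

section \<open>Efficient allocations of a partitioned profile\<close>

text \<open>Membership of the index in \<open>E\<close> decides how a cell is treated, since a cell
  can be both envy-free and monotonic.\<close>

locale partitioned_profile =
  fixes A :: "'a set" and N :: "'i set" and R :: "'i \<Rightarrow> 'a intensity_rel"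
    and s :: "'i \<Rightarrow> 'a \<Rightarrow> 'a \<Rightarrow> real" and K E :: "'k set"
    and Ns :: "'k \<Rightarrow> 'i set" and As :: "'k \<Rightarrow> 'a set"
  assumes fin: "finite A" "finite N" and cardN: "card N = card A"
    and can: "\<And>l. l \<in> N \<Longrightarrow> canonical_representation A (R l) (s l)"
    and disjN: "disjoint_family_on Ns K" and UN: "(\<Union>k\<in>K. Ns k) = N"
    and UA: "(\<Union>k\<in>K. As k) = A"
    and ef: "\<And>k. k \<in> K \<Longrightarrow> k \<in> E \<Longrightarrow> envy_free A R (Ns k) (As k)"
    and mon: "\<And>k. k \<in> K \<Longrightarrow> k \<notin> E \<Longrightarrow> monotonic A R s (Ns k) (As k)"
begin

lemma finite_cell: "k \<in> K \<Longrightarrow> finite (Ns k)" "k \<in> K \<Longrightarrow> finite (As k)"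
  using UN UA fin by (auto intro: finite_subset)

lemma cell_subset: "k \<in> K \<Longrightarrow> Ns k \<subseteq> N" "k \<in> K \<Longrightarrow> As k \<subseteq> A"
  using UN UA by auto

lemma allocationI_image: "y ` N = A \<Longrightarrow> allocation A N y"
  using fin cardN by (simp add: allocation_def bij_betw_def eq_card_imp_inj_on)

lemma card_cell: "k \<in> K \<Longrightarrow> card (Ns k) = card (As k)"
  using ef[of k] mon[of k] unfolding envy_free_def monotonic_def monotonic_enum_def by blast

text \<open>Cellwise improvements glue to an allocation that no agent finds worse than
  \<open>x\<close>. Pareto-efficiency forces it to equal \<open>x\<close>, which thus inherits the
  properties of the improvements.\<close>

lemma pareto_efficient_cells:
  assumes pe: "pareto_efficient A N R x" and k: "k \<in> K"
  shows "bij_betw x (Ns k) (As k)" and "k \<in> E \<Longrightarrow> i \<in> Ns k \<Longrightarrow> most_preferred A (R i) (x i)"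
proof -
  have x: "bij_betw x N A" using pe by (simp add: pareto_efficient_def allocation_def)
  define improves where "improves k h \<longleftrightarrow>
      h ` Ns k = As k \<and> (\<forall>i\<in>Ns k. h i = x i \<or> strict_pref (R i) (h i) (x i)) \<and>
      (k \<in> E \<longrightarrow> (\<forall>i\<in>Ns k. most_preferred A (R i) (h i)))" for k h
  have "\<exists>h. improves k h" if k: "k \<in> K" for k
  proof (cases "k \<in> E")
    case True
    have "x ` Ns k \<subseteq> A" using x cell_subset(1)[OF k] by (auto simp: bij_betw_def)
    from envy_free_improvement[OF ef[OF k True] finite_cell(2)[OF k] this]
    show ?thesis unfolding improves_def by blast
  next
    case False
    have xk: "inj_on x (Ns k)" "x ` Ns k \<subseteq> A"
      using x cell_subset(1)[OF k] by (auto simp: bij_betw_def intro: inj_on_subset)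
    have "top_preference_coincident A R (Ns k) (As k)"
      using mon[OF k False] by (auto simp: monotonic_def monotonic_enum_def)
    from top_preference_coincident_improvement[OF this card_cell[OF k] finite_cell[OF k] xk]
    show ?thesis using False unfolding improves_def by blast
  qed
  then obtain h where "\<And>k. k \<in> K \<Longrightarrow> improves k (h k)" by metis
  then have h: "\<And>k. k \<in> K \<Longrightarrow> h k ` Ns k = As k"
      "\<And>k i. k \<in> K \<Longrightarrow> i \<in> Ns k \<Longrightarrow> h k i = x i \<or> strict_pref (R i) (h k i) (x i)"
      "\<And>k i. k \<in> K \<Longrightarrow> k \<in> E \<Longrightarrow> i \<in> Ns k \<Longrightarrow> most_preferred A (R i) (h k i)"
    unfolding improves_def by blast+
  \<comment> \<open>The cell of an agent is unique by disjointness.\<close>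
  define y where "y i = h (THE k. k \<in> K \<and> i \<in> Ns k) i" for i
  have y: "y i = h k i" if "k \<in> K" "i \<in> Ns k" for k i
  proof -
    have "(THE k. k \<in> K \<and> i \<in> Ns k) = k"
      using that disjN by (intro the_equality) (auto simp: disjoint_family_on_def)
    then show ?thesis by (simp add: y_def)
  qed
  \<comment> \<open>It is enough that \<open>y\<close> is onto \<open>A\<close>, as \<open>N\<close>
    and \<open>A\<close> are finite and equally large.\<close>
  have "y ` N = (\<Union>k\<in>K. y ` Ns k)" using UN by auto
  also have "\<dots> = (\<Union>k\<in>K. As k)"
    using y h(1) by (intro SUP_cong) (auto simp flip: h(1))
  finally have "allocation A N y" using UA by (intro allocationI_image) simp
  moreover have "y i = x i \<or> strict_pref (R i) (y i) (x i)" if "i \<in> N" for i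
    using that UN y h(2) by (metis UN_E)
  ultimately have yx: "y i = x i" if "i \<in> N" for i
    using pareto_efficient_no_improvement[OF pe _ _ _ that]
      canonical_representation_weak_pref_refl[OF can] by blast
  have hx: "h k i = x i" if "i \<in> Ns k" for i
    using that y yx k cell_subset(1)[OF k] by (metis subsetD)
  show "bij_betw x (Ns k) (As k)"
    using hx h(1)[OF k] x cell_subset(1)[OF k]
    by (auto simp: bij_betw_def intro: inj_on_subset)
  show "most_preferred A (R i) (x i)" if "k \<in> E" "i \<in> Ns k"
    using hx h(3)[OF k] that by metis
qed

text \<open>A weak improvement \<open>z\<close> agrees with \<open>x\<close> everywhere: on cells in
  \<open>E\<close> since nothing beats a favourite, on the others by the comparison of rank
  sums.\<close>

lemma pareto_efficientI_cells:
  assumes x: "allocation A N x"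
    and bij: "\<And>k. k \<in> K \<Longrightarrow> k \<notin> E \<Longrightarrow> bij_betw x (Ns k) (As k)"
    and top: "\<And>k i. k \<in> K \<Longrightarrow> k \<in> E \<Longrightarrow> i \<in> Ns k \<Longrightarrow> most_preferred A (R i) (x i)"
  shows "pareto_efficient A N R x"
proof -
  have False if z: "allocation A N z" and weak: "\<forall>i\<in>N. weak_pref (R i) (z i) (x i)"
    and strict: "\<exists>i\<in>N. strict_pref (R i) (z i) (x i)" for z
  proof -
    obtain i where i: "i \<in> N" "strict_pref (R i) (z i) (x i)" using strict by blast
    obtain k where k: "k \<in> K" "i \<in> Ns k" using UN i(1) by blast
    have zN: "inj_on z N" "z ` N = A" using z by (auto simp: allocation_def bij_betw_def)
    have "z i = x i"
    proof (cases "k \<in> E")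
      case True
      then show ?thesis
        using most_preferred_weak_pref_eq[OF top[OF k(1) True k(2)]] zN(2) weak i(1) by blast
    next
      case False
      then obtain c where tpc: "top_preference_coincident A R (Ns k) (As k)"
        and rk: "ranks R (Ns k) (As k) c"
        using mon[OF k(1)] by (auto simp: monotonic_def monotonic_enum_def)
      show ?thesis
      proof (rule ranks_weak_pref_eq[OF tpc rk finite_cell(1)[OF k(1)] bij[OF k(1) False] _ _ _ k(2)])
        show "inj_on z (Ns k)" "z ` Ns k \<subseteq> A"
          using zN cell_subset(1)[OF k(1)] by (auto intro: inj_on_subset)
      qed (use weak cell_subset(1)[OF k(1)] in blast)
    qed
    with i(2) show False by (simp add: strict_pref_def)
  qed
  with x show ?thesis unfolding pareto_efficient_def by blast
qed

text \<open>Otherwise exchanging the items of \<open>i\<close> and \<open>j\<close> yields an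
  allocation that is still Pareto-efficient and intensity-dominates \<open>x\<close>.\<close>

lemma intensity_efficient_stable:
  assumes ie: "intensity_efficient A N R s x" and k: "k \<in> K" "k \<notin> E"
    and ij: "i \<in> Ns k" "j \<in> Ns k" "i \<noteq> j"
  shows "s i (x i) (x j) \<ge> s j (x i) (x j)"
proof (rule ccontr)
  assume neg: "\<not> s i (x i) (x j) \<ge> s j (x i) (x j)"
  have pe: "pareto_efficient A N R x" using ie by (simp add: intensity_efficient_def)
  have x: "bij_betw x N A" using pe by (simp add: pareto_efficient_def allocation_def)
  have ijN: "i \<in> N" "j \<in> N" using ij cell_subset(1)[OF k(1)] by auto
  define y where "y = x \<circ> transpose i j"
  have y: "y i = x j" "y j = x i" "\<And>l. l \<noteq> i \<Longrightarrow> l \<noteq> j \<Longrightarrow> y l = x l"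
    by (simp_all add: y_def)
  have swap: "bij_betw y S B" if "bij_betw x S B" "i \<in> S" "j \<in> S" for S B
    unfolding y_def by (rule bij_betw_trans[OF _ that(1)]) (use that in simp)
  have other: "i \<notin> Ns k'" "j \<notin> Ns k'" if "k' \<in> K" "k' \<noteq> k" for k'
    using disjN that k(1) ij by (auto simp: disjoint_family_on_def)
  \<comment> \<open>Cell \<open>k\<close> still receives \<open>As k\<close>, and every other cell,
    hence every cell in \<open>E\<close>, is untouched.\<close>
  have "pareto_efficient A N R y"
  proof (rule pareto_efficientI_cells)
    show "allocation A N y" using swap[OF x ijN] by (simp add: allocation_def)
    show "bij_betw y (Ns k') (As k')" if "k' \<in> K" "k' \<notin> E" for k'
    proof (cases "k' = k")
      case True
      then show ?thesis using swap[OF pareto_efficient_cells(1)[OF pe k(1)] ij(1,2)] by simp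
    next
      case False
      then have "y l = x l" if "l \<in> Ns k'" for l
        using that other[OF \<open>k' \<in> K\<close>] y(3) by metis
      then show ?thesis
        using pareto_efficient_cells(1)[OF pe \<open>k' \<in> K\<close>] by (simp cong: bij_betw_cong)
    qed
    show "most_preferred A (R l) (y l)" if "k' \<in> K" "k' \<in> E" "l \<in> Ns k'" for k' l
    proof -
      have "y l = x l" using that other[of k'] y(3) k(2) by metis
      then show ?thesis using pareto_efficient_cells(2)[OF pe that(1,2,3)] by simp
    qed
  qed
  moreover have "intensity_dominates N s y x"
  proof -
    \<comment> \<open>Dominance is tested for both orders of the exchanged pair; antisymmetry
      derives one from the other.\<close>
    have anti: "s l (x j) (x i) = - s l (x i) (x j)" if "l \<in> N" for l
      using canonical_representation_antisym[OF can[OF that]] x ijN by (auto simp: bij_betw_def)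
    \<comment> \<open>By injectivity of \<open>x\<close>, only \<open>i\<close> and \<open>j\<close>
      have exchanged items.\<close>
    have pair: "p = i \<and> q = j \<or> p = j \<and> q = i"
      if "p \<in> N" "q \<in> N" "p \<noteq> q" "y p = x q" "y q = x p" for p q
      using that x ijN y unfolding bij_betw_def inj_on_def by metis
    have "s p (y p) (y q) \<ge> s q (y p) (y q)"
      if "p \<in> N" "q \<in> N" "p \<noteq> q" "y p = x q" "y q = x p" for p q
      using pair[OF that] y neg anti ijN by auto
    moreover have "s j (y j) (y i) > s i (y j) (y i)" using y neg by simp
    ultimately show ?thesis
      unfolding intensity_dominates_def using ijN ij(3) y by metis
  qed
  ultimately show False using ie by (auto simp: intensity_efficient_def)
qed

text \<open>The enumeration witnessing strict monotonicity also witnesses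
  homeo-monotonicity.\<close>

lemma strictly_monotonic_imp_homeo_monotonic:
  assumes ie: "intensity_efficient A N R s x" and k: "k \<in> K"
    and sm: "strictly_monotonic A R s (Ns k) (As k)"
  shows "homeo_monotonic A R s (Ns k) (As k)"
proof -
  obtain c \<pi> where enum: "monotonic_enum A R s (Ns k) (As k) c \<pi>"
    and strict: "\<And>p q. p \<in> {1..<card (As k)} \<Longrightarrow> q \<in> {1..<card (As k)} \<Longrightarrow>
       s (\<pi> p) (c q) (c (q + 1)) > s (\<pi> (p + 1)) (c q) (c (q + 1))"
    using sm by (auto simp: strictly_monotonic_def)
  have tpc: "top_preference_coincident A R (Ns k) (As k)"
    and c: "bij_betw c {1..card (As k)} (As k)" and \<pi>: "bij_betw \<pi> {1..card (As k)} (Ns k)"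
    using enum by (auto simp: monotonic_enum_def ranks_def)
  have "s (\<pi> i) (c i) (c j) \<ge> s (\<pi> j) (c i) (c j)"
    if ij: "i \<in> {1..card (As k)}" "j \<in> {1..card (As k)}" "i < j" for i j
  proof (cases "k \<in> E")
    case True
    \<comment> \<open>So there is no pair \<open>i < j\<close> to check.\<close>
    then have "card (As k) \<le> 1"
      using envy_free_top_preference_coincident_card_le_1 ef k tpc cell_subset(2) by blast
    with ij show ?thesis by auto
  next
    case False
    have pe: "pareto_efficient A N R x" using ie by (simp add: intensity_efficient_def)
    note stable = intensity_efficient_stable[OF ie k False]
    have "x (\<pi> q) = c q" if "q \<in> {1..card (As k)}" for q
      using strictly_monotonic_assignment[OF pareto_efficient_cells(1)[OF pe k] \<pi> c] strict stable that
      by blast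
    moreover have "\<pi> i \<noteq> \<pi> j" "\<pi> i \<in> Ns k" "\<pi> j \<in> Ns k"
      using \<pi> ij by (auto simp: bij_betw_def dest: inj_onD)
    \<comment> \<open>With \<open>\<pi> i\<close> holding \<open>c i\<close> and
      \<open>\<pi> j\<close> holding \<open>c j\<close>, stability is the required
      inequality.\<close>
    ultimately show ?thesis using stable[of "\<pi> i" "\<pi> j"] ij by simp
  qed
  with enum show ?thesis unfolding homeo_monotonic_def by blast
qed

end

section \<open>Transfer to agents numbered from 1 to n\<close>

theorem theorem2:
  fixes A :: "'a set" and n m :: nat
    and R :: "nat \<Rightarrow> 'a intensity_rel"
    and s :: "nat \<Rightarrow> 'a \<Rightarrow> 'a \<Rightarrow> real"
    and Ns :: "nat \<Rightarrow> nat set" and As :: "nat \<Rightarrow> 'a set"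
  assumes "finite A" and "card A = n"
    and "strict_intensity_profile A {1..n} R"
    and "\<forall>l\<in>{1..n}. canonical_representation A (R l) (s l)"
    and "\<exists>x. intensity_efficient A {1..n} R s x"
    and "monotonic_envy_free_partition A {1..n} R s m Ns As"
  shows "\<forall>k\<in>{1..m}. strictly_monotonic A R s (Ns k) (As k) \<longrightarrow>
           homeo_monotonic A R s (Ns k) (As k)"
proof -
  obtain E where E: "\<forall>i\<in>E. envy_free A R (Ns i) (As i)"
      "\<forall>i\<in>{1..m} - E. monotonic A R s (Ns i) (As i)"
    using assms(6) unfolding monotonic_envy_free_partition_def by blast
  interpret partitioned_profile A "{1..n}" R s "{1..m}" E Ns As
    by unfold_locales
      (use assms E in \<open>auto simp: monotonic_envy_free_partition_def\<close>)
  show ?thesis using strictly_monotonic_imp_homeo_monotonic assms(5) by blast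
qed

end
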